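(* Let $\mathbf{A}=\langle A,\vee,\wedge,\ast,\to,\forall,\exists,0,1\rangle$ be an Epistemic BL-algebra. Then $\forall A=\exists A$, where $\forall A=\{\forall a:a\in A\}$ and $\exists A=\{\exists a:a\in A\}$. Moreover, $\exists A$ is closed under the operations $\vee,\wedge,\ast,\to,0,1$ of $\mathbf{A}$, so it is a BL-subalgebra of $\mathbf{A}$.
   Context: A BL-algebra is an algebra $\langle A,\wedge,\vee,\ast,\to,0,1\rangle$ such that $\langle A,\wedge,\vee,0,1\rangle$ is a bounded lattice (with order $\le$), $\langle A,\ast,1\rangle$ is a commutative monoid, $a\ast b\le c$ iff $a\le b\to c$ for all $a,b,c$, and the identities $a\wedge b=a\ast(a\to b)$ and $(a\to b)\vee(b\to a)=1$ hold. An Epistemic BL-algebra (EBL-algebra) is an algebra $\langle A,\vee,\wedge,\ast,\to,\forall,\exists,0,1\rangle$ whose reduct $\langle A,\vee,\wedge,\ast,\to,0,1\rangle$ is a BL-algebra and where $\forall,\exists$ are unary operations satisfying, for all $a,b$: (E$\forall$) $\forall 1=1$; (E$\exists$) $\exists 0=0$; (E1) $\forall a\to\exists a=1$; (E2) $\forall(a\to\forall b)=\exists a\to\forall b$; (E3) $\forall(\forall a\to b)=\forall a\to\forall b$; (E4) $\exists a\to\forall\exists a=1$; (E4a) $\forall(a\wedge b)=\forall a\wedge\forall b$; (E4b) $\exists(a\vee b)=\exists a\vee\exists b$; (E5) $\exists(a\ast\exists b)=\exists a\ast\exists b$. *)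

theory Defs
  imports "HOL-Algebra.Group"
begin

record 'a bl_struct = "'a monoid" +
  bl_meet :: "'a \<Rightarrow> 'a \<Rightarrow> 'a" (infixl \<open>\<^bold>\<and>\<index>\<close> 70)
  bl_join :: "'a \<Rightarrow> 'a \<Rightarrow> 'a" (infixl \<open>\<^bold>\<or>\<index>\<close> 65)
  bl_imp :: "'a \<Rightarrow> 'a \<Rightarrow> 'a" (infixr \<open>\<^bold>\<rightarrow>\<index>\<close> 60)
  bl_zero :: 'a (\<open>\<^bold>0\<index>\<close>)

definition bl_le :: "('a, 'm) bl_struct_scheme \<Rightarrow> 'a \<Rightarrow> 'a \<Rightarrow> bool" (infix \<open>\<^bold>\<le>\<index>\<close> 50)
  where "bl_le A a b \<longleftrightarrow> bl_meet A a b = a"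

locale bl_algebra = comm_monoid A for A :: "('a, 'm) bl_struct_scheme" (structure) +
  assumes meet_closed: "\<lbrakk>a \<in> carrier A; b \<in> carrier A\<rbrakk> \<Longrightarrow> a \<^bold>\<and> b \<in> carrier A"
    and join_closed: "\<lbrakk>a \<in> carrier A; b \<in> carrier A\<rbrakk> \<Longrightarrow> a \<^bold>\<or> b \<in> carrier A"
    and imp_closed: "\<lbrakk>a \<in> carrier A; b \<in> carrier A\<rbrakk> \<Longrightarrow> a \<^bold>\<rightarrow> b \<in> carrier A"
    and zero_closed: "\<^bold>0 \<in> carrier A"
    and meet_comm: "\<lbrakk>a \<in> carrier A; b \<in> carrier A\<rbrakk> \<Longrightarrow> a \<^bold>\<and> b = b \<^bold>\<and> a"
    and join_comm: "\<lbrakk>a \<in> carrier A; b \<in> carrier A\<rbrakk> \<Longrightarrow> a \<^bold>\<or> b = b \<^bold>\<or> a"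
    and meet_assoc: "\<lbrakk>a \<in> carrier A; b \<in> carrier A; c \<in> carrier A\<rbrakk>
          \<Longrightarrow> (a \<^bold>\<and> b) \<^bold>\<and> c = a \<^bold>\<and> (b \<^bold>\<and> c)"
    and join_assoc: "\<lbrakk>a \<in> carrier A; b \<in> carrier A; c \<in> carrier A\<rbrakk>
          \<Longrightarrow> (a \<^bold>\<or> b) \<^bold>\<or> c = a \<^bold>\<or> (b \<^bold>\<or> c)"
    and meet_absorb: "\<lbrakk>a \<in> carrier A; b \<in> carrier A\<rbrakk> \<Longrightarrow> a \<^bold>\<and> (a \<^bold>\<or> b) = a"
    and join_absorb: "\<lbrakk>a \<in> carrier A; b \<in> carrier A\<rbrakk> \<Longrightarrow> a \<^bold>\<or> (a \<^bold>\<and> b) = a"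
    and zero_least: "a \<in> carrier A \<Longrightarrow> \<^bold>0 \<^bold>\<le> a"
    and one_greatest: "a \<in> carrier A \<Longrightarrow> a \<^bold>\<le> \<one>"
    and residuation: "\<lbrakk>a \<in> carrier A; b \<in> carrier A; c \<in> carrier A\<rbrakk>
          \<Longrightarrow> a \<otimes> b \<^bold>\<le> c \<longleftrightarrow> a \<^bold>\<le> (b \<^bold>\<rightarrow> c)"
    and divisibility: "\<lbrakk>a \<in> carrier A; b \<in> carrier A\<rbrakk> \<Longrightarrow> a \<^bold>\<and> b = a \<otimes> (a \<^bold>\<rightarrow> b)"
    and prelinearity: "\<lbrakk>a \<in> carrier A; b \<in> carrier A\<rbrakk> \<Longrightarrow> (a \<^bold>\<rightarrow> b) \<^bold>\<or> (b \<^bold>\<rightarrow> a) = \<one>"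

record 'a ebl_struct = "'a bl_struct" +
  ebl_all :: "'a \<Rightarrow> 'a"
  ebl_ex :: "'a \<Rightarrow> 'a"

locale ebl_algebra = bl_algebra A for A :: "('a, 'm) ebl_struct_scheme" (structure) +
  assumes all_closed: "a \<in> carrier A \<Longrightarrow> ebl_all A a \<in> carrier A"
    and ex_closed: "a \<in> carrier A \<Longrightarrow> ebl_ex A a \<in> carrier A"
    and E_all: "ebl_all A \<one> = \<one>"
    and E_ex: "ebl_ex A \<^bold>0 = \<^bold>0"
    and E1: "a \<in> carrier A \<Longrightarrow> ebl_all A a \<^bold>\<rightarrow> ebl_ex A a = \<one>"
    and E2: "\<lbrakk>a \<in> carrier A; b \<in> carrier A\<rbrakk>
          \<Longrightarrow> ebl_all A (a \<^bold>\<rightarrow> ebl_all A b) = ebl_ex A a \<^bold>\<rightarrow> ebl_all A b"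
    and E3: "\<lbrakk>a \<in> carrier A; b \<in> carrier A\<rbrakk>
          \<Longrightarrow> ebl_all A (ebl_all A a \<^bold>\<rightarrow> b) = ebl_all A a \<^bold>\<rightarrow> ebl_all A b"
    and E4: "a \<in> carrier A \<Longrightarrow> ebl_ex A a \<^bold>\<rightarrow> ebl_all A (ebl_ex A a) = \<one>"
    and E4a: "\<lbrakk>a \<in> carrier A; b \<in> carrier A\<rbrakk>
          \<Longrightarrow> ebl_all A (a \<^bold>\<and> b) = ebl_all A a \<^bold>\<and> ebl_all A b"
    and E4b: "\<lbrakk>a \<in> carrier A; b \<in> carrier A\<rbrakk>
          \<Longrightarrow> ebl_ex A (a \<^bold>\<or> b) = ebl_ex A a \<^bold>\<or> ebl_ex A b"
    and E5: "\<lbrakk>a \<in> carrier A; b \<in> carrier A\<rbrakk>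
          \<Longrightarrow> ebl_ex A (a \<otimes> ebl_ex A b) = ebl_ex A a \<otimes> ebl_ex A b"

definition bl_closed :: "'a set \<Rightarrow> ('a, 'm) bl_struct_scheme \<Rightarrow> bool"
  where "bl_closed B A \<longleftrightarrow>
    (\<forall>a\<in>B. \<forall>b\<in>B. bl_join A a b \<in> B \<and> bl_meet A a b \<in> B \<and> mult A a b \<in> B \<and> bl_imp A a b \<in> B) \<and>
    bl_zero A \<in> B \<and> one A \<in> B"

definition bl_subalgebra :: "'a set \<Rightarrow> ('a, 'm) bl_struct_scheme \<Rightarrow> bool"
  where "bl_subalgebra B A \<longleftrightarrow>
    B \<subseteq> carrier A \<and> bl_closed B A \<and> bl_algebra (A\<lparr>carrier := B\<rparr>)"

end

theory Submission
  imports Defs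
begin

text \<open>The axioms force \<open>\<exists>1 = 1\<close>, whence (E2) and (E5) at \<open>a = 1\<close> make both quantifiers idempotent.
  Sandwiching with (E1) then gives \<open>\<forall>\<exists>a = \<exists>a\<close> and \<open>\<exists>\<forall>a = \<forall>a\<close>, so the images of the two quantifiers
  coincide with their common set of fixed points, which (E3), (E4a), (E4b) and (E5) show to be closed
  under the operations.\<close>

context bl_algebra
begin

lemma bl_le_antisym:
  "\<lbrakk>a \<in> carrier A; b \<in> carrier A; a \<^bold>\<le> b; b \<^bold>\<le> a\<rbrakk> \<Longrightarrow> a = b"
  using meet_comm[of a b] by (simp add: bl_le_def)

text \<open>Idempotence of meet follows from the two absorption laws: a meet (a join (a meet a)) is
  a, and its inner join collapses to a.\<close>

lemma bl_le_refl:
  assumes "a \<in> carrier A"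
  shows "a \<^bold>\<le> a"
  using meet_absorb[OF assms meet_closed[OF assms assms]] join_absorb[OF assms assms]
  by (simp add: bl_le_def)

lemma bl_imp_eq_one_iff:
  assumes "a \<in> carrier A" "b \<in> carrier A"
  shows "a \<^bold>\<rightarrow> b = \<one> \<longleftrightarrow> a \<^bold>\<le> b"
proof -
  have "a \<^bold>\<le> b \<longleftrightarrow> \<one> \<^bold>\<le> (a \<^bold>\<rightarrow> b)"
    using residuation[of \<one> a b] assms by simp
  also have "\<dots> \<longleftrightarrow> a \<^bold>\<rightarrow> b = \<one>"
    using assms bl_le_antisym bl_le_refl imp_closed one_closed one_greatest by metis
  finally show ?thesis by simp
qed

text \<open>Divisibility at the unit turns the implication into the meet of \<open>\<one>\<close>
  and a, which is a because \<open>\<one>\<close> is the top.\<close>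

lemma one_bl_imp:
  assumes "a \<in> carrier A"
  shows "\<one> \<^bold>\<rightarrow> a = a"
  using divisibility[of \<one> a] meet_comm[of \<one> a] one_greatest[of a] imp_closed[of \<one> a] assms
  by (simp add: bl_le_def)

text \<open>Apart from closure, every axiom is a universal statement about the operations, the order
  itself being an equation in meet, so it restricts to any closed subset.\<close>

lemma bl_subalgebra_if_closed:
  assumes sub: "B \<subseteq> carrier A" and closed: "bl_closed B A"
  shows "bl_subalgebra B A"
proof -
  have carr: "a \<in> carrier A" if "a \<in> B" for a
    using that sub by blast
  have "bl_algebra (A\<lparr>carrier := B\<rparr>)"
    by unfold_locales
      (use closed zero_least one_greatest residuation in
        \<open>auto simp: bl_closed_def bl_le_def carr m_assoc meet_assoc join_assoc
           meet_absorb join_absorb prelinearity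
           intro: m_comm meet_comm join_comm divisibility\<close>)
  with assms show ?thesis
    by (simp add: bl_subalgebra_def)
qed

end

context ebl_algebra
begin

lemma ex_one: "ebl_ex A \<one> = \<one>"
  using E1[of \<one>] by (simp add: E_all one_bl_imp ex_closed)

lemma all_all:
  "a \<in> carrier A \<Longrightarrow> ebl_all A (ebl_all A a) = ebl_all A a"
  using E2[of \<one> a] by (simp add: ex_one one_bl_imp all_closed)

lemma ex_ex:
  "a \<in> carrier A \<Longrightarrow> ebl_ex A (ebl_ex A a) = ebl_ex A a"
  using E5[of \<one> a] by (simp add: ex_one ex_closed)

lemma all_le_ex:
  "a \<in> carrier A \<Longrightarrow> ebl_all A a \<^bold>\<le> ebl_ex A a"
  using E1 bl_imp_eq_one_iff all_closed ex_closed by blast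

lemma all_ex:
  assumes "a \<in> carrier A"
  shows "ebl_all A (ebl_ex A a) = ebl_ex A a"
proof (rule bl_le_antisym)
  \<comment> \<open>(E1) is applied to \<open>ebl_ex A a\<close>, and idempotence removes the
    doubled quantifier on the right; the converse is (E4).\<close>
  show "ebl_all A (ebl_ex A a) \<^bold>\<le> ebl_ex A a"
    using all_le_ex[of "ebl_ex A a"] assms by (simp add: ex_ex ex_closed)
  show "ebl_ex A a \<^bold>\<le> ebl_all A (ebl_ex A a)"
    using E4[OF assms] bl_imp_eq_one_iff assms by (simp add: all_closed ex_closed)
qed (simp_all add: assms all_closed ex_closed)

lemma ex_all:
  assumes "a \<in> carrier A"
  shows "ebl_ex A (ebl_all A a) = ebl_all A a"
proof (rule bl_le_antisym)
  have "ebl_all A a \<^bold>\<rightarrow> ebl_all A a = \<one>"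
    using assms by (simp add: bl_imp_eq_one_iff bl_le_refl all_closed)
  \<comment> \<open>Instantiating (E2) with \<open>ebl_all A a\<close> in place of a makes its left
    side \<open>ebl_all A \<one>\<close>, which is \<open>\<one>\<close>.\<close>
  then have "ebl_ex A (ebl_all A a) \<^bold>\<rightarrow> ebl_all A a = \<one>"
    using E2[of "ebl_all A a" a] assms by (simp add: E_all all_closed)
  then show "ebl_ex A (ebl_all A a) \<^bold>\<le> ebl_all A a"
    using assms by (simp add: bl_imp_eq_one_iff all_closed ex_closed)
  show "ebl_all A a \<^bold>\<le> ebl_ex A (ebl_all A a)"
    using all_le_ex[of "ebl_all A a"] assms by (simp add: all_all all_closed)
qed (simp_all add: assms all_closed ex_closed)

lemma all_image_eq_ex_image: "ebl_all A ` carrier A = ebl_ex A ` carrier A"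
proof (intro equalityI image_subsetI)
  fix a assume a: "a \<in> carrier A"
  show "ebl_all A a \<in> ebl_ex A ` carrier A"
    using ex_all[OF a] all_closed[OF a] by (metis imageI)
  show "ebl_ex A a \<in> ebl_all A ` carrier A"
    using all_ex[OF a] ex_closed[OF a] by (metis imageI)
qed

lemma ex_image_iff:
  "x \<in> ebl_ex A ` carrier A \<longleftrightarrow> x \<in> carrier A \<and> ebl_ex A x = x"
  using ex_ex ex_closed by (metis imageE imageI)

text \<open>The same set is needed as fixed points of either quantifier: join and product are
  governed by axioms on \<open>ebl_ex\<close>, meet and implication by axioms on
  \<open>ebl_all\<close>.\<close>

lemma ex_image_iff_all:
  "x \<in> ebl_ex A ` carrier A \<longleftrightarrow> x \<in> carrier A \<and> ebl_all A x = x"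
  using all_all all_closed all_image_eq_ex_image by (metis imageE imageI)

lemma bl_closed_ex_image: "bl_closed (ebl_ex A ` carrier A) A"
  unfolding bl_closed_def
proof (intro conjI ballI)
  fix a b assume ab: "a \<in> ebl_ex A ` carrier A" "b \<in> ebl_ex A ` carrier A"
  have carr: "a \<in> carrier A" "b \<in> carrier A"
    and ex: "ebl_ex A a = a" "ebl_ex A b = b"
    using ab by (simp_all add: ex_image_iff)
  have all: "ebl_all A a = a" "ebl_all A b = b"
    using ab by (simp_all add: ex_image_iff_all)
  show "a \<^bold>\<or> b \<in> ebl_ex A ` carrier A"
    using carr ex by (simp add: ex_image_iff E4b join_closed)
  show "a \<^bold>\<and> b \<in> ebl_ex A ` carrier A"
    using carr all by (simp add: ex_image_iff_all E4a meet_closed)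
  show "a \<otimes> b \<in> ebl_ex A ` carrier A"
    using carr ex E5[of a b] by (simp add: ex_image_iff)
  show "a \<^bold>\<rightarrow> b \<in> ebl_ex A ` carrier A"
    using carr all E3[of a b] by (simp add: ex_image_iff_all imp_closed)
next
  show "\<^bold>0 \<in> ebl_ex A ` carrier A"
    by (simp add: ex_image_iff E_ex zero_closed)
  show "\<one> \<in> ebl_ex A ` carrier A"
    by (simp add: ex_image_iff ex_one)
qed

end

theorem theorem1:
  fixes A :: "('a, 'm) ebl_struct_scheme"
  assumes "ebl_algebra A"
  shows "ebl_all A ` carrier A = ebl_ex A ` carrier A
    \<and> bl_closed (ebl_ex A ` carrier A) A
    \<and> bl_subalgebra (ebl_ex A ` carrier A) A"
proof -
  interpret ebl_algebra A by fact
  have "ebl_ex A ` carrier A \<subseteq> carrier A"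
    using ex_closed by blast
  then show ?thesis
    using all_image_eq_ex_image bl_closed_ex_image bl_subalgebra_if_closed by blast
qed

end
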